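(* $(P^1_{USCB}(\widetilde X), H_{\rm send})$ is a completion of $(F^1_{USCB}(X), H_{\rm send})$, where $(F^1_{USCB}(X),H_{\rm send})$ is regarded as a subspace of $(P^1_{USCB}(\widetilde X), H_{\rm send})$ via the isometric embedding $u\mapsto {\rm send}\,u\subseteq X\times[0,1]\subseteq\widetilde X\times[0,1]$. That is, $(P^1_{USCB}(\widetilde X), H_{\rm send})$ is a complete metric space and the image of this isometric embedding is dense in it.
   Context: $(X,d)$ is a nonempty metric space and $(\widetilde X,\widetilde d)$ is its completion, with $X$ viewed as a (dense) subspace of $\widetilde X$. For any metric space $(Y,\rho)$, $Y\times[0,1]$ carries the metric $\overline\rho((x,\alpha),(y,\beta))=\rho(x,y)+|\alpha-\beta|$; $C(Y)$ and $K(Y)$ denote the sets of nonempty closed, respectively nonempty compact, subsets of $Y$; and $H(A,B)=\max\{\sup_{a\in A}\inf_{b\in B}\rho(a,b),\ \sup_{b\in B}\inf_{a\in A}\rho(a,b)\}$ is the Hausdorff distance (similarly on $C(Y\times[0,1])$ with $\overline\rho$). A fuzzy set in $Y$ is a function $u:Y\to[0,1]$, with $[u]_\alpha=\{x\in Y:u(x)\ge\alpha\}$ for $\alpha\in(0,1]$ and $[u]_0=\overline{\{x\in Y:u(x)>0\}}$. $F^1_{USCB}(Y)$ is the set of fuzzy sets $u$ in $Y$ with $[u]_\alpha\in C(Y)$ for all $\alpha\in[0,1]$ and $[u]_0\in K(Y)$. The sendograph is ${\rm send}\,u=\{(x,t)\in Y\times[0,1]:u(x)\ge t\}\cap([u]_0\times[0,1])$,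 and $H_{\rm send}(u,v)=H({\rm send}\,u,{\rm send}\,v)$ on $F^1_{USCB}(Y)$. For $u\subseteq Y\times[0,1]$ put $\langle u\rangle_\alpha=\{x:(x,\alpha)\in u\}$. $P^1_{USCB}(Y)$ is the set of $u\subseteq Y\times[0,1]$ such that $\langle u\rangle_\alpha\in K(Y)$ for all $\alpha\in[0,1]$ and $\langle u\rangle_\alpha=\bigcap_{\beta<\alpha}\langle u\rangle_\beta$ for all $\alpha\in(0,1]$ (here $\beta\in[0,\alpha)$); such $u$ are compact subsets of $Y\times[0,1]$, and $H_{\rm send}(u,v)=H(u,v)$ for $u,v\in P^1_{USCB}(Y)$. *)

theory Defs
  imports "HOL-Analysis.Analysis"
begin

text \<open>
  Metric spaces are given by a carrier \<open>Y\<close> and a distance \<open>d\<close> on it, as in the library locale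
  \<^locale>\<open>Metric_space\<close>. A completion is given, as usual, by an isometric map \<open>e\<close> with dense image
  in a complete space; \<open>e = id\<close> is the case where \<open>M\<close> is literally a subspace of \<open>M'\<close>.
\<close>

definition completion_via ::
  "('a \<Rightarrow> 'b) \<Rightarrow> 'a set \<Rightarrow> ('a \<Rightarrow> 'a \<Rightarrow> real) \<Rightarrow> 'b set \<Rightarrow> ('b \<Rightarrow> 'b \<Rightarrow> real) \<Rightarrow> bool"
  where "completion_via e M d M' d' \<longleftrightarrow>
    Metric_space M d \<and> Metric_space M' d' \<and> Metric_space.mcomplete M' d' \<and>
    e \<in> M \<rightarrow> M' \<and> (\<forall>x\<in>M. \<forall>y\<in>M. d' (e x) (e y) = d x y) \<and>
    Metric_space.mtopology M' d' closure_of (e ` M) = M'"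

definition sum_dist :: "('a \<Rightarrow> 'a \<Rightarrow> real) \<Rightarrow> 'a \<times> real \<Rightarrow> 'a \<times> real \<Rightarrow> real"
  where "sum_dist d p q = d (fst p) (fst q) + \<bar>snd p - snd q\<bar>"

definition closed_sets :: "'a set \<Rightarrow> ('a \<Rightarrow> 'a \<Rightarrow> real) \<Rightarrow> 'a set set"
  where "closed_sets Y d = {A. A \<noteq> {} \<and> closedin (Metric_space.mtopology Y d) A}"

definition compact_sets :: "'a set \<Rightarrow> ('a \<Rightarrow> 'a \<Rightarrow> real) \<Rightarrow> 'a set set"
  where "compact_sets Y d = {A. A \<noteq> {} \<and> compactin (Metric_space.mtopology Y d) A}"

text \<open>The Hausdorff distance of unbounded sets may be infinite, hence the extended values.\<close>

definition hausdorff :: "('a \<Rightarrow> 'a \<Rightarrow> real) \<Rightarrow> 'a set \<Rightarrow> 'a set \<Rightarrow> ennreal"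
  where "hausdorff \<rho> A B =
    max (SUP a\<in>A. INF b\<in>B. ennreal (\<rho> a b)) (SUP b\<in>B. INF a\<in>A. ennreal (\<rho> a b))"

definition level_cut :: "'a set \<Rightarrow> ('a \<Rightarrow> 'a \<Rightarrow> real) \<Rightarrow> ('a \<Rightarrow> real) \<Rightarrow> real \<Rightarrow> 'a set"
  where "level_cut Y d u \<alpha> =
    (if \<alpha> = 0 then Metric_space.mtopology Y d closure_of {x\<in>Y. u x > 0}
     else {x\<in>Y. u x \<ge> \<alpha>})"

text \<open>
  Fuzzy sets in \<open>Y\<close> are extensional functions, so that two of them are equal as soon as they
  agree on \<open>Y\<close>.
\<close>

definition F_USCB1 :: "'a set \<Rightarrow> ('a \<Rightarrow> 'a \<Rightarrow> real) \<Rightarrow> ('a \<Rightarrow> real) set"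
  where "F_USCB1 Y d = {u \<in> Y \<rightarrow>\<^sub>E {0..1}.
    (\<forall>\<alpha>\<in>{0..1}. level_cut Y d u \<alpha> \<in> closed_sets Y d) \<and>
    level_cut Y d u 0 \<in> compact_sets Y d}"

definition send :: "'a set \<Rightarrow> ('a \<Rightarrow> 'a \<Rightarrow> real) \<Rightarrow> ('a \<Rightarrow> real) \<Rightarrow> ('a \<times> real) set"
  where "send Y d u =
    {(x, t). x \<in> Y \<and> t \<in> {0..1} \<and> u x \<ge> t} \<inter> (level_cut Y d u 0 \<times> {0..1})"

definition slice :: "('a \<times> real) set \<Rightarrow> real \<Rightarrow> 'a set"
  where "slice u \<alpha> = {x. (x, \<alpha>) \<in> u}"

definition P_USCB1 :: "'a set \<Rightarrow> ('a \<Rightarrow> 'a \<Rightarrow> real) \<Rightarrow> ('a \<times> real) set set"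
  where "P_USCB1 Y d = {u. u \<subseteq> Y \<times> {0..1} \<and>
    (\<forall>\<alpha>\<in>{0..1}. slice u \<alpha> \<in> compact_sets Y d) \<and>
    (\<forall>\<alpha>\<in>{0<..1}. slice u \<alpha> = (\<Inter>\<beta>\<in>{0..<\<alpha>}. slice u \<beta>))}"

text \<open>
  The metric on \<open>P_USCB1 Y d\<close> and, through \<open>send\<close>, on \<open>F_USCB1 Y d\<close>. Since \<open>enn2real \<infinity> = 0\<close>, these
  can be metrics only if the Hausdorff distances involved are finite, which they are for
  nonempty compact sets.
\<close>

definition H_send_P :: "('a \<Rightarrow> 'a \<Rightarrow> real) \<Rightarrow> ('a \<times> real) set \<Rightarrow> ('a \<times> real) set \<Rightarrow> real"
  where "H_send_P d u v = enn2real (hausdorff (sum_dist d) u v)"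

definition H_send_F ::
  "'a set \<Rightarrow> ('a \<Rightarrow> 'a \<Rightarrow> real) \<Rightarrow> ('a \<Rightarrow> real) \<Rightarrow> ('a \<Rightarrow> real) \<Rightarrow> real"
  where "H_send_F Y d u v = enn2real (hausdorff (sum_dist d) (send Y d u) (send Y d v))"

end

theory Submission
  imports Defs
begin

text \<open>
  The Hausdorff distance makes the nonempty compact subsets of a metric space \<open>M\<close> into a metric space
  (\<open>Metric_space_hdist\<close>), and this hyperspace is complete whenever \<open>M\<close> is (\<open>mcomplete_hdist\<close>): a
  Cauchy sequence of compact sets converges to the set of all points that the sequence eventually
  comes arbitrarily close to.

  The sets in \<open>P_USCB1 M d\<close> are defined through their slices, but they can be described without
  slices (\<open>P_USCB1_iff\<close>): they are the compact subsets of \<open>M \<times> [0,1]\<close> that contain with a point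
  everything vertically below it, down to height \<open>0\<close>, and that reach height \<open>1\<close> somewhere. For
  compact slices, the intersection condition amounts to this vertical monotonicity together with
  closedness of the whole set.
  In this form it is easy to see that the property survives Hausdorff limits
  (\<open>P_USCB1_if_approx\<close>). So \<open>P_USCB1 M d\<close> is closed in the hyperspace of \<open>M \<times> \<real>\<close> and inherits
  completeness from it.

  The slices of a sendograph are the level cuts of its fuzzy set, so sendographs of members of
  \<open>F_USCB1 X d\<close> lie in \<open>P_USCB1 X d\<close> and determine the fuzzy set. An isometry \<open>e\<close> into \<open>X'\<close> carries
  them to members of \<open>P_USCB1 X' d'\<close> without changing Hausdorff distances.

  The image is dense, although it can be a proper subset even when \<open>X\<close> is complete: a set in
  \<open>P_USCB1 X' d'\<close> may have points of height \<open>0\<close> far from all points of positive height, which no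
  sendograph has. To approximate such a set, take a finite net of it, move the base points into the
  dense set \<open>e ` X\<close>, and lift all heights to at least a small \<open>\<delta> > 0\<close>. The
  fuzzy set with finite support whose graph these points generate is close to the given set
  (\<open>send_image_dense\<close>).
\<close>

section \<open>The hyperspace of compact sets\<close>

text \<open>
  The real-valued Hausdorff distance for an arbitrary distance \<open>\<rho>\<close>, so that results on the
  hyperspace of any metric space apply to \<open>H_send_P\<close>, which is the case \<open>\<rho> = sum_dist d\<close>.
\<close>

definition hdist :: "('a \<Rightarrow> 'a \<Rightarrow> real) \<Rightarrow> 'a set \<Rightarrow> 'a set \<Rightarrow> real"
  where "hdist \<rho> A B = enn2real (hausdorff \<rho> A B)"

lemma hausdorff_leI:
  assumes "\<And>a. a \<in> A \<Longrightarrow> \<exists>b\<in>B. \<rho> a b \<le> r" and "\<And>b. b \<in> B \<Longrightarrow> \<exists>a\<in>A. \<rho> a b \<le> r"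
  shows "hausdorff \<rho> A B \<le> ennreal r"
  unfolding hausdorff_def
proof (rule max.boundedI)
  show "(SUP a\<in>A. INF b\<in>B. ennreal (\<rho> a b)) \<le> ennreal r"
    by (rule SUP_least) (use assms(1) in \<open>meson INF_lower2 ennreal_leI\<close>)
  show "(SUP b\<in>B. INF a\<in>A. ennreal (\<rho> a b)) \<le> ennreal r"
    by (rule SUP_least) (use assms(2) in \<open>meson INF_lower2 ennreal_leI\<close>)
qed

lemma hdist_leI:
  assumes "0 \<le> r"
    and "\<And>a. a \<in> A \<Longrightarrow> \<exists>b\<in>B. \<rho> a b \<le> r" and "\<And>b. b \<in> B \<Longrightarrow> \<exists>a\<in>A. \<rho> a b \<le> r"
  shows "hdist \<rho> A B \<le> r"
  unfolding hdist_def by (intro enn2real_leI hausdorff_leI assms)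

lemma hdist_nonneg: "0 \<le> hdist \<rho> A B"
  by (simp add: hdist_def)

lemma hdist_commute:
  assumes "\<And>x y. \<rho> x y = \<rho> y x"
  shows "hdist \<rho> A B = hdist \<rho> B A"
  unfolding hdist_def hausdorff_def by (subst (1 2) assms) (simp add: max.commute)

lemma hdist_isometric_image:
  assumes "\<And>p q. p \<in> A \<Longrightarrow> q \<in> B \<Longrightarrow> \<rho>' (f p) (f q) = \<rho> p q"
  shows "hdist \<rho>' (f ` A) (f ` B) = hdist \<rho> A B"
  unfolding hdist_def hausdorff_def image_image
  by (intro arg_cong[where f = enn2real] arg_cong2[where f = max] SUP_cong INF_cong refl)
    (simp_all add: assms)

context Metric_space
begin

lemma compact_sets_subset: "A \<in> compact_sets M d \<Longrightarrow> A \<subseteq> M"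
  unfolding compact_sets_def using compactin_subset_topspace by fastforce

lemma mem_compact_sets_if_approx:
  assumes "A \<in> compact_sets M d" "x \<in> M" "\<And>\<epsilon>. \<epsilon> > 0 \<Longrightarrow> \<exists>a\<in>A. d x a < \<epsilon>"
  shows "x \<in> A"
proof -
  have "closedin mtopology A"
    using assms(1) compactin_imp_closedin[OF Hausdorff_space_mtopology]
    by (auto simp: compact_sets_def)
  moreover have "x \<in> mtopology closure_of A"
    using assms compact_sets_subset[OF assms(1)] by (auto simp: metric_closure_of)
  ultimately show ?thesis
    by (simp add: closure_of_closedin)
qed

lemma hausdorff_compact_finite:
  assumes A: "A \<in> compact_sets M d" and B: "B \<in> compact_sets M d"
  shows "hausdorff d A B < top"
proof -
  have "mbounded (A \<union> B)"
    unfolding mbounded_Un using A B compactin_imp_mbounded by (simp add: compact_sets_def)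
  then obtain r where r: "\<And>x y. x \<in> A \<union> B \<Longrightarrow> y \<in> A \<union> B \<Longrightarrow> d x y \<le> r"
    by (meson mbounded_alt)
  have "hausdorff d A B \<le> ennreal r"
    by (rule hausdorff_leI) (use r A B in \<open>auto simp: compact_sets_def\<close>)
  also have "\<dots> < top" by simp
  finally show ?thesis .
qed

text \<open>
  Together with \<open>hdist_leI\<close> this lets every later argument speak of pairs of nearby points only.
  Compactness makes the extended distance finite, so that \<open>enn2real\<close> does not collapse
  it to \<open>0\<close>.
\<close>

lemma hdist_lessD:
  assumes "A \<in> compact_sets M d" "B \<in> compact_sets M d" "hdist d A B < r" "a \<in> A"
  shows "\<exists>b\<in>B. d a b < r"
proof -
  have "(INF b\<in>B. ennreal (d a b)) \<le> hausdorff d A B"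
    unfolding hausdorff_def using \<open>a \<in> A\<close> by (intro max.coboundedI1) (rule SUP_upper)
  also have "\<dots> < ennreal r"
    using assms(3) hausdorff_compact_finite[OF assms(1,2)] by (simp add: hdist_def)
  finally show ?thesis
    by (auto simp: INF_less_iff ennreal_less_iff)
qed

lemma hdist_zero_imp_subset:
  assumes "A \<in> compact_sets M d" "B \<in> compact_sets M d" "hdist d A B = 0"
  shows "A \<subseteq> B"
proof
  fix a assume "a \<in> A"
  then show "a \<in> B"
    using mem_compact_sets_if_approx[OF assms(2)] hdist_lessD[OF assms(1,2)] assms(3)
      compact_sets_subset[OF assms(1)] by (metis subsetD)
qed

theorem Metric_space_hdist: "Metric_space (compact_sets M d) (hdist d)"
proof
  fix A B C
  show "0 \<le> hdist d A B" by (rule hdist_nonneg)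
  show comm: "hdist d A B = hdist d B A" for A B by (rule hdist_commute) (rule commute)
  show "hdist d A B = 0 \<longleftrightarrow> A = B" if A: "A \<in> compact_sets M d" and B: "B \<in> compact_sets M d"
  proof
    show "A = B" if "hdist d A B = 0"
      using hdist_zero_imp_subset A B that comm by (metis subset_antisym)
    have "\<exists>b\<in>A. d a b \<le> 0" "\<exists>b\<in>A. d b a \<le> 0" if "a \<in> A" for a
      using that compact_sets_subset[OF A] by (auto intro!: bexI[of _ a])
    then have "hdist d A A \<le> 0" by (intro hdist_leI) auto
    then show "hdist d A B = 0" if "A = B"
      using hdist_nonneg[of d A A] that by simp
  qed
  show "hdist d A C \<le> hdist d A B + hdist d B C"
    if A: "A \<in> compact_sets M d" and B: "B \<in> compact_sets M d" and C: "C \<in> compact_sets M d"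
  proof (rule field_le_epsilon)
    fix \<epsilon> :: real assume "\<epsilon> > 0"
    \<comment> \<open>Intermediate points are only available at distances slightly above the infima, so both
      distances are enlarged before chaining.\<close>
    define r s where "r = hdist d A B + \<epsilon> / 2" and "s = hdist d B C + \<epsilon> / 2"
    have rs: "hdist d A B < r" "hdist d B A < r" "hdist d B C < s" "hdist d C B < s"
      using \<open>\<epsilon> > 0\<close> by (simp_all add: r_def s_def comm[of C] comm[of B A])
    have one: "\<exists>c\<in>C. d a c \<le> r + s"
      if prems: "a \<in> A" "hdist d A B < r" "hdist d B C < s"
        and A: "A \<in> compact_sets M d" and C: "C \<in> compact_sets M d"
      for a A C r s
    proof -
      obtain b where b: "b \<in> B" "d a b < r" using hdist_lessD[OF A B prems(2,1)] by blast
      obtain c where c: "c \<in> C" "d b c < s" using hdist_lessD[OF B C prems(3) b(1)] by blast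
      show ?thesis
        using triangle[of a b c] b c prems compact_sets_subset[OF A] compact_sets_subset[OF B]
          compact_sets_subset[OF C] by (intro bexI[of _ c]) (auto simp: subset_iff)
    qed
    have "hdist d A C \<le> r + s"
    proof (rule hdist_leI)
      show "0 \<le> r + s" using rs hdist_nonneg[of d A B] hdist_nonneg[of d B C] by linarith
      show "\<exists>c\<in>C. d a c \<le> r + s" if "a \<in> A" for a using one that rs A C by blast
      show "\<exists>a\<in>A. d a c \<le> r + s" if that: "c \<in> C" for c
        using one[OF that rs(4,2) C A] by (simp add: commute add.commute)
    qed
    then show "hdist d A C \<le> hdist d A B + hdist d B C + \<epsilon>"
      by (simp add: r_def s_def)
  qed
qed

text \<open>
  The lower limit in the sense of Kuratowski; for a Cauchy sequence of compact sets in a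
  complete space it turns out to be the limit in the Hausdorff distance.
\<close>

definition lower_limit :: "(nat \<Rightarrow> 'a set) \<Rightarrow> 'a set"
  where "lower_limit u = {z \<in> M. \<forall>\<epsilon>>0. \<exists>N. \<forall>n\<ge>N. \<exists>y\<in>u n. d z y < \<epsilon>}"

lemma lower_limitD:
  assumes "z \<in> lower_limit u" "\<epsilon> > 0"
  obtains N where "\<And>n. n \<ge> N \<Longrightarrow> \<exists>y\<in>u n. d z y < \<epsilon>"
  using assms unfolding lower_limit_def by blast

text \<open>
  A point \<open>y\<close> of a late member of the sequence can be followed through later and later members, with
  jumps bounded by \<open>\<epsilon> / 2^k\<close>; the resulting path converges to a point of the lower limit, and the
  jumps add up to at most \<open>2 * \<epsilon>\<close>.
\<close>

lemma lower_limit_approx: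
  assumes "mcomplete"
    and u: "\<And>n. u n \<in> compact_sets M d"
    and cauchy: "\<And>\<epsilon>. \<epsilon> > 0 \<Longrightarrow> \<exists>N. \<forall>p\<ge>N. \<forall>q\<ge>N. hdist d (u p) (u q) < \<epsilon>"
    and "\<epsilon> > 0" and n: "\<And>p q. p \<ge> n \<Longrightarrow> q \<ge> n \<Longrightarrow> hdist d (u p) (u q) < \<epsilon>"
    and "y \<in> u n"
  shows "\<exists>z\<in>lower_limit u. d y z \<le> 2 * \<epsilon>"
proof -
  \<comment> \<open>A state of the construction is an index together with a point of the set with that index;
    from this index on, the sets differ by less than the next jump.\<close>
  define P where "P k my \<longleftrightarrow> snd my \<in> u (fst my) \<and> (k = 0 \<longrightarrow> snd my = y) \<and>
     (\<forall>p\<ge>fst my. \<forall>q\<ge>fst my. hdist d (u p) (u q) < \<epsilon> / 2 ^ k)" for k :: nat and my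
  have "\<exists>f. \<forall>k. P k (f k) \<and> d (snd (f k)) (snd (f (Suc k))) < \<epsilon> / 2 ^ k"
  proof (rule dependent_nat_choice)
    show "\<exists>x. P 0 x"
      using n \<open>y \<in> u n\<close> by (intro exI[of _ "(n, y)"]) (auto simp: P_def)
  next
    fix my k assume my: "P k my"
    obtain N where N: "\<forall>p\<ge>N. \<forall>q\<ge>N. hdist d (u p) (u q) < \<epsilon> / 2 ^ Suc k"
      using cauchy[of "\<epsilon> / 2 ^ Suc k"] \<open>\<epsilon> > 0\<close> by auto
    define m' where "m' = max N (fst my)"
    have "hdist d (u (fst my)) (u m') < \<epsilon> / 2 ^ k"
      using my by (simp add: P_def m'_def)
    moreover have "snd my \<in> u (fst my)"
      using my by (simp add: P_def)
    ultimately obtain y' where "y' \<in> u m'" "d (snd my) y' < \<epsilon> / 2 ^ k"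
      using hdist_lessD[OF u u] by blast
    then show "\<exists>my'. P (Suc k) my' \<and> d (snd my) (snd my') < \<epsilon> / 2 ^ k"
      using N by (intro exI[of _ "(m', y')"]) (auto simp: P_def m'_def)
  qed
  then obtain f where f: "\<And>k. P k (f k)"
    and step: "\<And>k. d (snd (f k)) (snd (f (Suc k))) < \<epsilon> / 2 ^ k" by blast
  define m s where "m k = fst (f k)" and "s k = snd (f k)" for k
  have s: "s k \<in> u (m k)" "s 0 = y" "d (s k) (s (Suc k)) < \<epsilon> / 2 ^ k" for k
    using f[of k] f[of 0] step[of k] by (simp_all add: P_def m_def s_def)
  have m: "hdist d (u p) (u q) < \<epsilon> / 2 ^ k" if "p \<ge> m k" "q \<ge> m k" for p q k
    using f[of k] that by (simp add: P_def m_def)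
  have sM [simp]: "s k \<in> M" for k
    using s(1) u compact_sets_subset by blast
  \<comment> \<open>The geometric sum is kept in closed form, so that the induction goes through.\<close>
  have tail: "d (s k) (s (k + i)) \<le> 2 * \<epsilon> / 2 ^ k - 2 * \<epsilon> / 2 ^ (k + i)" for k i
  proof (induction i)
    case 0
    then show ?case by simp
  next
    case (Suc i)
    have "d (s k) (s (k + Suc i)) \<le> d (s k) (s (k + i)) + \<epsilon> / 2 ^ (k + i)"
      using triangle[of "s k" "s (k + i)" "s (k + Suc i)"] s(3)[of "k + i"] by simp
    also have "\<dots> \<le> 2 * \<epsilon> / 2 ^ k - 2 * \<epsilon> / 2 ^ (k + i) + \<epsilon> / 2 ^ (k + i)"
      using Suc by simp
    also have "\<dots> = 2 * \<epsilon> / 2 ^ k - 2 * \<epsilon> / 2 ^ (k + Suc i)"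
      by simp
    finally show ?case .
  qed
  have tail': "d (s k) (s j) \<le> 2 * \<epsilon> / 2 ^ k" if "k \<le> j" for k j
  proof -
    have "0 \<le> 2 * \<epsilon> / 2 ^ j" using \<open>\<epsilon> > 0\<close> by simp
    then show ?thesis
      using tail[of k "j - k"] that by simp
  qed
  have small: "\<exists>k. c * \<epsilon> / 2 ^ k < \<delta>" if pos: "\<delta> > 0" "c > 0" for \<delta> c :: real
  proof -
    have "0 < \<delta> / (c * \<epsilon>)" using pos \<open>\<epsilon> > 0\<close> by simp
    then obtain k where "(1 / 2) ^ k < \<delta> / (c * \<epsilon>)"
      using real_arch_pow_inv[of "\<delta> / (c * \<epsilon>)" "1 / 2"] by auto
    then show ?thesis
      using pos \<open>\<epsilon> > 0\<close> by (intro exI[of _ k]) (simp add: field_simps)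
  qed
  have "MCauchy s"
    unfolding MCauchy_def
  proof (intro conjI allI impI)
    fix \<delta> :: real assume "\<delta> > 0"
    then obtain k where k: "4 * \<epsilon> / 2 ^ k < \<delta>" using small[of \<delta> 4] by auto
    have "d (s i) (s j) < \<delta>" if "k \<le> i" "k \<le> j" for i j
      using triangle[of "s i" "s k" "s j"] tail'[OF that(1)] tail'[OF that(2)] k
        commute[of "s i" "s k"] by simp
    then show "\<exists>N. \<forall>n n'. N \<le> n \<longrightarrow> N \<le> n' \<longrightarrow> d (s n) (s n') < \<delta>"
      by blast
  qed auto
  then obtain z where z: "limitin mtopology s z sequentially"
    using \<open>mcomplete\<close> by (auto simp: mcomplete_def)
  then have "z \<in> M" by (rule limitin_mspace)
  have sz: "d (s k) z \<le> 2 * \<epsilon> / 2 ^ k" for k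
  proof (rule field_le_epsilon)
    fix \<delta> :: real assume "\<delta> > 0"
    then obtain N where "\<forall>j\<ge>N. d (s j) z < \<delta>"
      using z by (auto simp: limit_metric_sequentially)
    then have "d (s (max N k)) z < \<delta>" by simp
    then show "d (s k) z \<le> 2 * \<epsilon> / 2 ^ k + \<delta>"
      using triangle[of "s k" "s (max N k)" z] tail'[of k "max N k"] \<open>z \<in> M\<close> by simp
  qed
  have "z \<in> lower_limit u"
    unfolding lower_limit_def
  proof (intro CollectI conjI allI impI)
    fix \<delta> :: real assume "\<delta> > 0"
    then obtain k where k: "3 * \<epsilon> / 2 ^ k < \<delta>" using small[of \<delta> 3] by auto
    have "\<exists>y\<in>u p. d z y < \<delta>" if p: "p \<ge> m k" for p
    proof -
      obtain y' where y': "y' \<in> u p" "d (s k) y' < \<epsilon> / 2 ^ k"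
        using hdist_lessD[OF u u _ s(1)] m[OF order_refl p] by blast
      then have "y' \<in> M" using u compact_sets_subset by blast
      then have "d z y' < \<delta>"
        using triangle[of z "s k" y'] y' sz[of k] k \<open>z \<in> M\<close> commute[of z "s k"] by simp
      then show ?thesis using y' by blast
    qed
    then show "\<exists>N. \<forall>n\<ge>N. \<exists>y\<in>u n. d z y < \<delta>" by blast
  qed (fact \<open>z \<in> M\<close>)
  then show ?thesis
    using sz[of 0] s(2) by (intro bexI[of _ z]) auto
qed

text \<open>
  Every point of the lower limit is by definition close to all late members, and by
  \<open>lower_limit_approx\<close> every point of a late member is close to the lower limit. This is convergence,
  once the lower limit is known to be compact. It is closed, and it inherits finite nets from a late
  member, so completeness of the space makes it compact.
\<close>

theorem mcomplete_hdist:
  assumes "mcomplete"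
  shows "Metric_space.mcomplete (compact_sets M d) (hdist d)"
proof -
  interpret H: Metric_space "compact_sets M d" "hdist d" by (rule Metric_space_hdist)
  show ?thesis
    unfolding H.mcomplete_def
  proof (intro allI impI)
    fix u :: "nat \<Rightarrow> 'a set" assume "H.MCauchy u"
    then have u: "\<And>n. u n \<in> compact_sets M d"
      by (auto simp: H.MCauchy_def)
    have cauchy: "\<exists>N. \<forall>p\<ge>N. \<forall>q\<ge>N. hdist d (u p) (u q) < \<epsilon>" if "\<epsilon> > 0" for \<epsilon>
      using \<open>H.MCauchy u\<close> that unfolding H.MCauchy_def by meson
    define L where "L = lower_limit u"
    have LM: "L \<subseteq> M" by (auto simp: L_def lower_limit_def)
    have near: "\<exists>N. \<forall>n\<ge>N. (\<forall>z\<in>L. \<exists>y\<in>u n. d z y \<le> \<epsilon>) \<and> (\<forall>y\<in>u n. \<exists>z\<in>L. d z y \<le> \<epsilon>)"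
      if pos: "\<epsilon> > 0" for \<epsilon>
    proof -
      obtain N where N: "\<And>p q. p \<ge> N \<Longrightarrow> q \<ge> N \<Longrightarrow> hdist d (u p) (u q) < \<epsilon> / 2"
        using cauchy[OF half_gt_zero[OF pos]] by blast
      show ?thesis
      proof (intro exI[of _ N] allI impI conjI ballI)
        fix n z assume "n \<ge> N" "z \<in> L"
        then obtain N' where "\<And>n. n \<ge> N' \<Longrightarrow> \<exists>y\<in>u n. d z y < \<epsilon> / 2"
          using pos lower_limitD[of z u "\<epsilon> / 2"] by (auto simp: L_def)
        \<comment> \<open>The limit point is approximated by a member beyond \<open>N'\<close>, from which the Cauchy
          property leads back to the index \<open>n\<close>.\<close>
        then obtain y where y: "y \<in> u (max N N')" "d z y < \<epsilon> / 2" by (meson max.cobounded2)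
        then obtain y' where y': "y' \<in> u n" "d y y' < \<epsilon> / 2"
          using hdist_lessD[OF u u N] \<open>n \<ge> N\<close> by (meson max.cobounded1)
        have "z \<in> M" "y \<in> M" "y' \<in> M"
          using y y' \<open>z \<in> L\<close> LM compact_sets_subset[OF u] by auto
        with y y' triangle[of z y y'] show "\<exists>y\<in>u n. d z y \<le> \<epsilon>"
          by (intro bexI[of _ y']) auto
      next
        fix n y assume "n \<ge> N" "y \<in> u n"
        have "\<exists>z\<in>lower_limit u. d y z \<le> 2 * (\<epsilon> / 2)"
          by (rule lower_limit_approx[OF assms u cauchy _ _ \<open>y \<in> u n\<close>])
            (use N pos \<open>n \<ge> N\<close> in auto)
        then show "\<exists>z\<in>L. d z y \<le> \<epsilon>"
          by (auto simp: L_def commute)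
      qed
    qed
    have "mtotally_bounded L"
      unfolding mtotally_bounded_def
    proof (intro allI impI)
      fix \<epsilon> :: real assume "\<epsilon> > 0"
      then obtain n where n1: "\<forall>z\<in>L. \<exists>y\<in>u n. d z y \<le> \<epsilon> / 4"
        and n2: "\<forall>y\<in>u n. \<exists>z\<in>L. d z y \<le> \<epsilon> / 4"
        using near[of "\<epsilon> / 4"] by auto
      have "mtotally_bounded (u n)"
        using u compactin_imp_mtotally_bounded by (auto simp: compact_sets_def)
      then obtain K where K: "finite K" "K \<subseteq> u n" "u n \<subseteq> (\<Union>x\<in>K. mball x (\<epsilon> / 4))"
        unfolding mtotally_bounded_def using \<open>\<epsilon> > 0\<close> by (meson divide_pos_pos zero_less_numeral)
      obtain g where g: "\<And>y. y \<in> u n \<Longrightarrow> g y \<in> L" "\<And>y. y \<in> u n \<Longrightarrow> d (g y) y \<le> \<epsilon> / 4"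
        using n2 by metis
      \<comment> \<open>The net \<open>K\<close> of the late member is transported into \<open>L\<close> by the nearby points \<open>g\<close>.\<close>
      have "L \<subseteq> (\<Union>x\<in>g ` K. mball x \<epsilon>)"
      proof
        fix z assume "z \<in> L"
        then obtain y where y: "y \<in> u n" "d z y \<le> \<epsilon> / 4" using n1 by blast
        then obtain k where k: "k \<in> K" "d k y < \<epsilon> / 4" using K(3) by force
        have in_M: "z \<in> M" "y \<in> M" "k \<in> M" "g k \<in> M"
          using y k K(2) g(1) \<open>z \<in> L\<close> LM compact_sets_subset[OF u[of n]] by blast+
        have "d (g k) k \<le> \<epsilon> / 4" using g(2) k K(2) by blast
        then have "d (g k) z < \<epsilon>"
          using triangle[of "g k" k z] triangle[of k y z] in_M y k \<open>\<epsilon> > 0\<close> commute[of y z]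
          by linarith
        then show "z \<in> (\<Union>x\<in>g ` K. mball x \<epsilon>)" using k(1) in_M by auto
      qed
      then show "\<exists>K. finite K \<and> K \<subseteq> L \<and> L \<subseteq> (\<Union>x\<in>K. mball x \<epsilon>)"
        using K g(1) by (intro exI[of _ "g ` K"]) auto
    qed
    then have "compactin mtopology (mtopology closure_of L)"
      using mtotally_bounded_eq_compact_closure_of[OF assms] by blast
    moreover have "mtopology closure_of L \<subseteq> L"
    proof
      fix z assume z: "z \<in> mtopology closure_of L"
      then have "z \<in> M" by (auto simp: metric_closure_of)
      moreover have "\<exists>N. \<forall>n\<ge>N. \<exists>y\<in>u n. d z y < \<epsilon>" if pos: "\<epsilon> > 0" for \<epsilon>
      proof -
        obtain z' where z': "z' \<in> L" "d z z' < \<epsilon> / 2"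
          using z half_gt_zero[OF pos] unfolding metric_closure_of in_mball by blast
        then obtain N where N: "\<And>n. n \<ge> N \<Longrightarrow> \<exists>y\<in>u n. d z' y < \<epsilon> / 2"
          using pos z' lower_limitD[of z' u "\<epsilon> / 2"] by (auto simp: L_def)
        have "\<exists>y\<in>u n. d z y < \<epsilon>" if n: "n \<ge> N" for n
        proof -
          obtain y where y: "y \<in> u n" "d z' y < \<epsilon> / 2" using N[OF n] by blast
          have "z' \<in> M" "y \<in> M" using z' y LM compact_sets_subset[OF u] by auto
          then show ?thesis
            using triangle[of z z' y] \<open>z \<in> M\<close> y z' by (intro bexI[of _ y]) auto
        qed
        then show ?thesis by blast
      qed
      ultimately show "z \<in> L" by (simp add: L_def lower_limit_def)
    qed
    ultimately have "compactin mtopology L"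
      using closure_of_subset[of L mtopology] LM by (metis subset_antisym topspace_mtopology)
    moreover have "L \<noteq> {}"
    proof -
      obtain n where "\<forall>y\<in>u n. \<exists>z\<in>L. d z y \<le> 1" using near[of 1] by auto
      then show ?thesis using u[of n] by (auto simp: compact_sets_def)
    qed
    ultimately have L: "L \<in> compact_sets M d" by (simp add: compact_sets_def)
    have "limitin H.mtopology u L sequentially"
      unfolding H.limit_metric_sequentially
    proof (intro conjI allI impI)
      fix \<epsilon> :: real assume "\<epsilon> > 0"
      then obtain N where N: "\<And>n. n \<ge> N \<Longrightarrow>
          (\<forall>z\<in>L. \<exists>y\<in>u n. d z y \<le> \<epsilon> / 2) \<and> (\<forall>y\<in>u n. \<exists>z\<in>L. d z y \<le> \<epsilon> / 2)"
        using near[of "\<epsilon> / 2"] by auto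
      have "hdist d (u n) L < \<epsilon>" if "n \<ge> N" for n
      proof -
        have "hdist d (u n) L \<le> \<epsilon> / 2"
          by (rule hdist_leI) (use N[OF that] \<open>\<epsilon> > 0\<close> in \<open>auto simp: commute\<close>)
        then show ?thesis using \<open>\<epsilon> > 0\<close> by simp
      qed
      then show "\<exists>N. \<forall>n\<ge>N. u n \<in> compact_sets M d \<and> hdist d (u n) L < \<epsilon>"
        using u by blast
    qed (fact L)
    then show "\<exists>L. limitin H.mtopology u L sequentially" by blast
  qed
qed

end

section \<open>The product with the real line\<close>

context Metric_space
begin

lemma closedin_if_approx:
  assumes "A \<subseteq> M"
    and "\<And>x. x \<in> M \<Longrightarrow> (\<And>\<epsilon>. \<epsilon> > 0 \<Longrightarrow> \<exists>a\<in>A. d x a < \<epsilon>) \<Longrightarrow> x \<in> A"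
  shows "closedin mtopology A"
proof -
  have "mtopology closure_of A \<subseteq> A"
    using assms(2) unfolding metric_closure_of in_mball by blast
  then show ?thesis
    using assms(1) closure_of_subset_eq[of A mtopology] by simp
qed

lemma Metric_space_sum_dist: "Metric_space (M \<times> UNIV) (sum_dist d)"
proof
  fix p q r :: "'a \<times> real"
  show "0 \<le> sum_dist d p q" by (simp add: sum_dist_def)
  show "sum_dist d p q = sum_dist d q p" by (simp add: sum_dist_def commute)
  show "sum_dist d p q = 0 \<longleftrightarrow> p = q" if "p \<in> M \<times> UNIV" "q \<in> M \<times> UNIV"
  proof -
    have "sum_dist d p q = 0 \<longleftrightarrow> d (fst p) (fst q) = 0 \<and> \<bar>snd p - snd q\<bar> = 0"
      unfolding sum_dist_def by (rule add_nonneg_eq_0_iff) auto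
    then show ?thesis using that by (auto simp: prod_eq_iff)
  qed
  show "sum_dist d p r \<le> sum_dist d p q + sum_dist d q r"
    if "p \<in> M \<times> UNIV" "q \<in> M \<times> UNIV" "r \<in> M \<times> UNIV"
    using triangle[of "fst p" "fst q" "fst r"] that by (auto simp: sum_dist_def)
qed

lemma le_sum_dist:
  "d (fst p) (fst q) \<le> sum_dist d p q" "\<bar>snd p - snd q\<bar> \<le> sum_dist d p q"
  by (auto simp: sum_dist_def)

text \<open>
  This brings in the library facts on compactness in product topologies and on the continuity of
  the projections.
\<close>

lemma mtopology_sum_dist:
  "Metric_space.mtopology (M \<times> UNIV) (sum_dist d) = prod_topology mtopology euclideanreal"
proof -
  interpret S: Metric_space "M \<times> (UNIV :: real set)" "sum_dist d" by (rule Metric_space_sum_dist)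
  have "openin S.mtopology U \<longleftrightarrow> openin (prod_topology mtopology euclideanreal) U" for U
  proof
    assume U: "openin S.mtopology U"
    show "openin (prod_topology mtopology euclideanreal) U"
      unfolding openin_prod_topology_alt
    proof (intro allI impI)
      fix x t assume "(x, t) \<in> U"
      then obtain r where r: "r > 0" "S.mball (x, t) r \<subseteq> U" and "x \<in> M"
        using U unfolding S.openin_mtopology by blast
      have "mball x (r / 2) \<times> ball t (r / 2) \<subseteq> S.mball (x, t) r"
        by (auto simp: sum_dist_def dist_real_def)
      then show "\<exists>V W. openin mtopology V \<and> openin euclideanreal W \<and> x \<in> V \<and> t \<in> W \<and> V \<times> W \<subseteq> U"
        using r \<open>x \<in> M\<close>
        by (intro exI[of _ "mball x (r / 2)"] exI[of _ "ball t (r / 2)"])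
            auto
    qed
  next
    assume U: "openin (prod_topology mtopology euclideanreal) U"
    show "openin S.mtopology U"
      unfolding S.openin_mtopology
    proof (intro conjI allI impI)
      show "U \<subseteq> M \<times> UNIV" using openin_subset[OF U] by simp
      fix p assume "p \<in> U"
      then obtain x t where p: "p = (x, t)" "(x, t) \<in> U" by (cases p) auto
      then obtain V W where VW: "openin mtopology V" "open W" "x \<in> V" "t \<in> W" "V \<times> W \<subseteq> U"
        using U unfolding openin_prod_topology_alt by (metis open_openin)
      obtain r where r: "r > 0" "mball x r \<subseteq> V"
        using VW unfolding openin_mtopology by blast
      obtain s where s: "s > 0" "ball t s \<subseteq> W"
        using VW by (meson open_contains_ball)
      have "S.mball p (min r s) \<subseteq> mball x r \<times> ball t s"
      proof
        fix q assume q: "q \<in> S.mball p (min r s)"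
        have "0 \<le> d x (fst q)" by simp
        with q show "q \<in> mball x r \<times> ball t s"
          using le_sum_dist[of p q] by (cases q) (auto simp: p dist_real_def)
      qed
      then show "\<exists>r>0. S.mball p r \<subseteq> U"
        using r s VW(5) by (intro exI[of _ "min r s"] conjI) (simp, blast)
    qed
  qed
  then show ?thesis by (simp add: topology_eq)
qed

lemma mcomplete_sum_dist:
  assumes "mcomplete"
  shows "Metric_space.mcomplete (M \<times> UNIV) (sum_dist d)"
proof -
  interpret S: Metric_space "M \<times> (UNIV :: real set)" "sum_dist d" by (rule Metric_space_sum_dist)
  show ?thesis
    unfolding S.mcomplete_def
  proof (intro allI impI)
    fix \<sigma> assume \<sigma>: "S.MCauchy \<sigma>"
    then have Cauchy: "\<exists>N. \<forall>m n. N \<le> m \<longrightarrow> N \<le> n \<longrightarrow> sum_dist d (\<sigma> m) (\<sigma> n) < \<epsilon>" if "\<epsilon> > 0" for \<epsilon>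
      using that by (simp add: S.MCauchy_def)
    have components: "\<exists>N. \<forall>m n. N \<le> m \<longrightarrow> N \<le> n \<longrightarrow>
        d (fst (\<sigma> m)) (fst (\<sigma> n)) < \<epsilon> \<and> \<bar>snd (\<sigma> m) - snd (\<sigma> n)\<bar> < \<epsilon>" if pos: "\<epsilon> > 0" for \<epsilon>
    proof -
      obtain N where N: "\<And>m n. N \<le> m \<Longrightarrow> N \<le> n \<Longrightarrow> sum_dist d (\<sigma> m) (\<sigma> n) < \<epsilon>"
        using Cauchy[OF pos] by metis
      show ?thesis
        by (intro exI[of _ N] allI impI conjI le_sum_dist[THEN order_le_less_trans] N)
    qed
    have "fst (\<sigma> n) \<in> M" for n
      using \<sigma> by (auto simp: S.MCauchy_def image_subset_iff mem_Times_iff)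
    then have "MCauchy (fst \<circ> \<sigma>)"
      using components unfolding MCauchy_def comp_apply by (metis image_subset_iff)
    then obtain x where x: "limitin mtopology (fst \<circ> \<sigma>) x sequentially"
      using assms by (auto simp: mcomplete_def)
    have "Cauchy (snd \<circ> \<sigma>)"
      using components unfolding Cauchy_def dist_real_def comp_apply by metis
    then obtain t where t: "(snd \<circ> \<sigma>) \<longlonglongrightarrow> t"
      using convergent_eq_Cauchy by blast
    have "limitin (prod_topology mtopology euclideanreal) \<sigma> (x, t) sequentially"
      using x t by (simp add: limitin_pairwise)
    then show "\<exists>p. limitin S.mtopology \<sigma> p sequentially"
      by (auto simp: mtopology_sum_dist)
  qed
qed

section \<open>Completeness of the space of sendograph-like sets\<close>

lemma compact_sets_sum_dist_iff:
  "u \<in> compact_sets (M \<times> UNIV) (sum_dist d) \<longleftrightarrow>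
    u \<noteq> {} \<and> compactin (prod_topology mtopology euclideanreal) u"
  by (simp add: compact_sets_def mtopology_sum_dist)

lemma slice_antimono:
  assumes "u \<in> P_USCB1 M d" "0 \<le> \<beta>" "\<beta> \<le> \<alpha>" "\<alpha> \<le> 1"
  shows "slice u \<alpha> \<subseteq> slice u \<beta>"
proof (cases "\<beta> = \<alpha>")
  case False
  then have "\<alpha> \<in> {0<..1}" "\<beta> \<in> {0..<\<alpha>}" using assms by auto
  then show ?thesis using assms(1) unfolding P_USCB1_def by blast
qed simp

text \<open>
  Since the set lies in the compact box \<open>slice u 0 \<times> [0,1]\<close>, it suffices that it is closed. If
  \<open>(x, t)\<close> is a limit of points of \<open>u\<close>, their heights eventually exceed any \<open>\<beta> < t\<close>, so that \<open>x\<close> is a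
  limit of points of the closed set \<open>slice u \<beta>\<close>; the intersection of these slices is \<open>slice u t\<close>.
\<close>

lemma P_USCB1_imp_compact:
  assumes u: "u \<in> P_USCB1 M d"
  shows "u \<in> compact_sets (M \<times> UNIV) (sum_dist d)"
proof -
  interpret S: Metric_space "M \<times> (UNIV :: real set)" "sum_dist d" by (rule Metric_space_sum_dist)
  have sub: "u \<subseteq> M \<times> {0..1}"
    and slices: "\<And>\<alpha>. \<alpha> \<in> {0..1} \<Longrightarrow> slice u \<alpha> \<in> compact_sets M d"
    using u by (auto simp: P_USCB1_def)
  have "closedin S.mtopology u"
  proof (rule S.closedin_if_approx)
    fix p assume "p \<in> M \<times> (UNIV :: real set)"
      and near: "\<And>\<epsilon>. \<epsilon> > 0 \<Longrightarrow> \<exists>q\<in>u. sum_dist d p q < \<epsilon>"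
    then obtain x t where p: "p = (x, t)" "x \<in> M" by auto
    have near': "\<exists>y s. (y, s) \<in> u \<and> d x y < \<epsilon> \<and> \<bar>t - s\<bar> < \<epsilon>" if pos: "\<epsilon> > 0" for \<epsilon>
    proof -
      obtain q where "q \<in> u" "sum_dist d p q < \<epsilon>" using near[OF pos] by blast
      then show ?thesis
        using le_sum_dist[of "(x, t)" q] unfolding p
        by (intro exI[of _ "fst q"] exI[of _ "snd q"]) auto
    qed
    have "t \<le> 1 + \<epsilon>" "0 \<le> t + \<epsilon>" if "\<epsilon> > 0" for \<epsilon>
      using near'[OF that] sub by force+
    then have t: "0 \<le> t" "t \<le> 1" using field_le_epsilon[of 0 t] field_le_epsilon[of t 1] by auto
    \<comment> \<open>The case \<open>\<beta> = 0\<close> is included to cover \<open>t = 0\<close>, for which the interval from \<open>0\<close> to \<open>t\<close> contains no \<open>\<beta> < t\<close>.\<close>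
    have in_slice: "x \<in> slice u \<beta>" if \<beta>: "0 \<le> \<beta>" "\<beta> < t \<or> \<beta> = 0" for \<beta>
    proof (rule mem_compact_sets_if_approx[OF slices \<open>x \<in> M\<close>])
      show "\<beta> \<in> {0..1}" using \<beta> t by auto
      fix \<epsilon> :: real assume "\<epsilon> > 0"
      define \<delta> where "\<delta> = (if \<beta> = 0 then \<epsilon> else min \<epsilon> (t - \<beta>))"
      have "\<delta> > 0" using \<beta> \<open>\<epsilon> > 0\<close> by (auto simp: \<delta>_def)
      then obtain y s where y: "(y, s) \<in> u" "d x y < \<delta>" "\<bar>t - s\<bar> < \<delta>" using near' by blast
      have s: "0 \<le> s" "s \<le> 1" using y sub by auto
      have "\<beta> \<le> s" using y(3) s by (auto simp: \<delta>_def split: if_splits)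
      then have "y \<in> slice u \<beta>"
        using slice_antimono[OF u \<beta>(1) _ s(2)] y(1) by (auto simp: slice_def)
      moreover have "d x y < \<epsilon>" using y(2) by (auto simp: \<delta>_def split: if_splits)
      ultimately show "\<exists>a\<in>slice u \<beta>. d x a < \<epsilon>" by blast
    qed
    have "x \<in> slice u t"
    proof (cases "t = 0")
      case False
      then have "slice u t = (\<Inter>\<beta>\<in>{0..<t}. slice u \<beta>)" using u t by (simp add: P_USCB1_def)
      then show ?thesis using in_slice by auto
    qed (use in_slice in auto)
    then show "p \<in> u" by (simp add: p slice_def)
  qed (use sub in auto)
  moreover have "compactin S.mtopology (slice u 0 \<times> {0..1})"
    using slices[of 0] by (simp add: mtopology_sum_dist compactin_Times compact_sets_def)
  moreover have "u \<subseteq> slice u 0 \<times> {0..1}"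
    using slice_antimono[OF u order_refl] sub by (fastforce simp: slice_def)
  ultimately have "compactin S.mtopology u" by (meson closed_compactin)
  moreover have "u \<noteq> {}" using slices[of 0] by (auto simp: compact_sets_def slice_def)
  ultimately show ?thesis by (simp add: compact_sets_def)
qed

text \<open>
  From right to left, a slice is the projection of a closed part of the compact set, and
  the point \<open>(x, \<alpha>)\<close> is a limit of the points \<open>(x, \<beta>)\<close> for \<open>\<beta>\<close> increasing to \<open>\<alpha>\<close>, which gives the
  intersection condition.
\<close>

lemma P_USCB1_iff:
  "u \<in> P_USCB1 M d \<longleftrightarrow>
    u \<in> compact_sets (M \<times> UNIV) (sum_dist d) \<and> u \<subseteq> M \<times> {0..1} \<and>
    (\<forall>x t s. (x, t) \<in> u \<longrightarrow> 0 \<le> s \<longrightarrow> s \<le> t \<longrightarrow> (x, s) \<in> u) \<and> slice u 1 \<noteq> {}"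
proof (intro iffI conjI allI impI)
  assume u: "u \<in> P_USCB1 M d"
  show "u \<in> compact_sets (M \<times> UNIV) (sum_dist d)" by (rule P_USCB1_imp_compact[OF u])
  show sub: "u \<subseteq> M \<times> {0..1}" using u by (simp add: P_USCB1_def)
  have "\<forall>\<alpha>\<in>{0..1}. slice u \<alpha> \<in> compact_sets M d" using u unfolding P_USCB1_def by blast
  then have "slice u 1 \<in> compact_sets M d" by (rule bspec) simp
  then show "slice u 1 \<noteq> {}" by (simp add: compact_sets_def)
  show "(x, s) \<in> u" if "(x, t) \<in> u" "0 \<le> s" "s \<le> t" for x t s
  proof -
    have "t \<le> 1" using that(1) sub by auto
    then show ?thesis using slice_antimono[OF u that(2,3)] that(1) by (auto simp: slice_def)
  qed
next
  interpret S: Metric_space "M \<times> (UNIV :: real set)" "sum_dist d" by (rule Metric_space_sum_dist)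
  assume "u \<in> compact_sets (M \<times> UNIV) (sum_dist d) \<and> u \<subseteq> M \<times> {0..1} \<and>
    (\<forall>x t s. (x, t) \<in> u \<longrightarrow> 0 \<le> s \<longrightarrow> s \<le> t \<longrightarrow> (x, s) \<in> u) \<and> slice u 1 \<noteq> {}"
  then have u: "u \<in> compact_sets (M \<times> UNIV) (sum_dist d)" and sub: "u \<subseteq> M \<times> {0..1}"
    and down: "\<And>x t s. (x, t) \<in> u \<Longrightarrow> 0 \<le> s \<Longrightarrow> s \<le> t \<Longrightarrow> (x, s) \<in> u"
    and one: "slice u 1 \<noteq> {}" by blast+
  have "slice u \<alpha> \<in> compact_sets M d" if \<alpha>: "\<alpha> \<in> {0..1}" for \<alpha>
  proof -
    let ?T = "prod_topology mtopology euclideanreal"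
    have "closedin ?T {p \<in> topspace ?T. snd p \<in> {\<alpha>}}"
      by (rule closedin_continuous_map_preimage[OF continuous_map_snd]) auto
    then have "compactin ?T (u \<inter> {p \<in> topspace ?T. snd p \<in> {\<alpha>}})"
      using u by (intro compact_Int_closedin) (auto simp: compact_sets_sum_dist_iff)
    then have "compactin mtopology (fst ` (u \<inter> {p \<in> topspace ?T. snd p \<in> {\<alpha>}}))"
      by (rule image_compactin[OF _ continuous_map_fst])
    moreover have "fst ` (u \<inter> {p \<in> topspace ?T. snd p \<in> {\<alpha>}}) = slice u \<alpha>"
      using sub by (force simp: slice_def image_iff)
    moreover have "slice u \<alpha> \<noteq> {}" using one down \<alpha> by (fastforce simp: slice_def)
    ultimately show ?thesis by (simp add: compact_sets_def)
  qed
  moreover have "slice u \<alpha> = (\<Inter>\<beta>\<in>{0..<\<alpha>}. slice u \<beta>)" if \<alpha>: "\<alpha> \<in> {0<..1}" for \<alpha>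
  proof
    show "slice u \<alpha> \<subseteq> (\<Inter>\<beta>\<in>{0..<\<alpha>}. slice u \<beta>)" using down by (auto simp: slice_def)
    show "(\<Inter>\<beta>\<in>{0..<\<alpha>}. slice u \<beta>) \<subseteq> slice u \<alpha>"
    proof
      fix x assume x: "x \<in> (\<Inter>\<beta>\<in>{0..<\<alpha>}. slice u \<beta>)"
      then have "x \<in> slice u 0" using \<alpha> by auto
      then have "x \<in> M" using sub by (auto simp: slice_def)
      have "(x, \<alpha>) \<in> u"
      proof (rule S.mem_compact_sets_if_approx[OF u])
        fix \<epsilon> :: real assume "\<epsilon> > 0"
        define \<beta> where "\<beta> = max 0 (\<alpha> - \<epsilon> / 2)"
        have "\<beta> \<in> {0..<\<alpha>}" using \<alpha> \<open>\<epsilon> > 0\<close> by (auto simp: \<beta>_def)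
        then have "(x, \<beta>) \<in> u" using x by (auto simp: slice_def)
        moreover have "sum_dist d (x, \<alpha>) (x, \<beta>) < \<epsilon>"
          using \<open>x \<in> M\<close> \<open>\<epsilon> > 0\<close> \<alpha> by (auto simp: sum_dist_def \<beta>_def max_def)
        ultimately show "\<exists>q\<in>u. sum_dist d (x, \<alpha>) q < \<epsilon>" by blast
      qed (use \<open>x \<in> M\<close> in simp)
      then show "x \<in> slice u \<alpha>" by (simp add: slice_def)
    qed
  qed
  ultimately show "u \<in> P_USCB1 M d" using sub by (simp add: P_USCB1_def)
qed

text \<open>
  The space is closed under Hausdorff limits. The conditions in \<open>P_USCB1_iff\<close> are
  transferred from an approximating set up to an error \<open>\<epsilon>\<close>. Vertical monotonicity then holds exactly
  because the limit \<open>K\<close> is closed, and the height \<open>1\<close> is attained because the set of heights of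
  \<open>K\<close> is compact.
\<close>

lemma P_USCB1_if_approx:
  assumes K: "K \<in> compact_sets (M \<times> UNIV) (sum_dist d)"
    and near: "\<And>\<epsilon>. \<epsilon> > 0 \<Longrightarrow> \<exists>u\<in>P_USCB1 M d. hdist (sum_dist d) K u < \<epsilon>"
  shows "K \<in> P_USCB1 M d"
  unfolding P_USCB1_iff
proof (intro conjI allI impI)
  interpret S: Metric_space "M \<times> (UNIV :: real set)" "sum_dist d" by (rule Metric_space_sum_dist)
  have approx: "\<exists>u\<in>P_USCB1 M d. (\<forall>p\<in>K. \<exists>q\<in>u. sum_dist d p q < \<epsilon>) \<and>
      (\<forall>q\<in>u. \<exists>p\<in>K. sum_dist d q p < \<epsilon>)" if pos: "\<epsilon> > 0" for \<epsilon>
  proof -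
    obtain u where u: "u \<in> P_USCB1 M d" "hdist (sum_dist d) K u < \<epsilon>" using near[OF pos] by blast
    moreover have "hdist (sum_dist d) u K = hdist (sum_dist d) K u"
      by (rule hdist_commute) (rule S.commute)
    ultimately show ?thesis
      using S.hdist_lessD[OF K P_USCB1_imp_compact] S.hdist_lessD[OF P_USCB1_imp_compact K]
      by (intro bexI[of _ u]) auto
  qed
  have KM: "K \<subseteq> M \<times> UNIV" by (rule S.compact_sets_subset[OF K])
  show "K \<in> compact_sets (M \<times> UNIV) (sum_dist d)" by (rule K)
  show "K \<subseteq> M \<times> {0..1}"
  proof
    fix p assume p: "p \<in> K"
    have "snd p \<le> 1 + \<epsilon> \<and> 0 \<le> snd p + \<epsilon>" if "\<epsilon> > 0" for \<epsilon>
    proof -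
      obtain u q where "u \<in> P_USCB1 M d" "q \<in> u" and q: "sum_dist d p q < \<epsilon>"
        using approx[OF \<open>\<epsilon> > 0\<close>] p by blast
      then have "0 \<le> snd q" "snd q \<le> 1" by (auto simp: P_USCB1_iff)
      then show ?thesis using le_sum_dist(2)[of p q] q by auto
    qed
    then have "snd p \<le> 1" "0 \<le> snd p"
      using field_le_epsilon[of 0 "snd p"] field_le_epsilon[of "snd p" 1] by auto
    then show "p \<in> M \<times> {0..1}" using p KM by (auto simp: mem_Times_iff)
  qed
  show "(x, s) \<in> K" if xt: "(x, t) \<in> K" and s: "0 \<le> s" "s \<le> t" for x t s
  proof (rule S.mem_compact_sets_if_approx[OF K])
    show xM: "(x, s) \<in> M \<times> UNIV" using xt KM by auto
    fix \<epsilon> :: real assume "\<epsilon> > 0"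
    then obtain u where u: "u \<in> P_USCB1 M d" "\<And>p. p \<in> K \<Longrightarrow> \<exists>q\<in>u. sum_dist d p q < \<epsilon> / 2"
       "\<And>q. q \<in> u \<Longrightarrow> \<exists>p\<in>K. sum_dist d q p < \<epsilon> / 2"
      using approx[of "\<epsilon> / 2"] by auto
    obtain y t' where y: "(y, t') \<in> u" "sum_dist d (x, t) (y, t') < \<epsilon> / 2"
      using u(2)[OF xt] by auto
    then have t': "0 \<le> t'" and "y \<in> M" using u(1) by (auto simp: P_USCB1_iff)
    \<comment> \<open>Truncating the height \<open>t'\<close> at \<open>s\<close> keeps the point below \<open>(y, t')\<close>, and the new
      height differs from \<open>s\<close> by at most \<open>|t - t'|\<close>.\<close>
    have "(y, min s t') \<in> u" using u(1) y(1) s t' unfolding P_USCB1_iff by auto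
    then obtain p where p: "p \<in> K" "sum_dist d (y, min s t') p < \<epsilon> / 2" using u(3) by blast
    have "sum_dist d (x, s) (y, min s t') \<le> sum_dist d (x, t) (y, t')"
      using s by (auto simp: sum_dist_def)
    then have "sum_dist d (x, s) p < \<epsilon>"
      using S.triangle[of "(x, s)" "(y, min s t')" p] xM \<open>y \<in> M\<close> p KM y(2) by auto
    then show "\<exists>p\<in>K. sum_dist d (x, s) p < \<epsilon>" using p by blast
  qed
  have "compactin (prod_topology mtopology euclideanreal) K"
    using K by (simp add: compact_sets_sum_dist_iff)
  then have "compact (snd ` K)"
    using image_compactin[OF _ continuous_map_snd] by (metis compactin_euclidean_iff)
  then have "closed (snd ` K)" by (rule compact_imp_closed)
  moreover have "1 \<in> closure (snd ` K)"
    unfolding closure_approachable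
  proof (intro allI impI)
    fix \<epsilon> :: real assume "\<epsilon> > 0"
    then obtain u where u: "u \<in> P_USCB1 M d" "\<And>q. q \<in> u \<Longrightarrow> \<exists>p\<in>K. sum_dist d q p < \<epsilon>"
      using approx by blast
    then obtain y where "(y, 1) \<in> u" by (auto simp: P_USCB1_iff slice_def)
    then obtain p where p: "p \<in> K" "sum_dist d (y, 1) p < \<epsilon>" using u(2) by blast
    then have "\<bar>1 - snd p\<bar> < \<epsilon>" using le_sum_dist(2)[of "(y, 1)" p] by simp
    then show "\<exists>y\<in>snd ` K. dist y 1 < \<epsilon>" using p by (auto simp: dist_real_def abs_minus_commute)
  qed
  ultimately have "1 \<in> snd ` K" by (simp add: closure_closed)
  then show "slice K 1 \<noteq> {}" by (force simp: slice_def)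
qed

lemma H_send_P_eq: "H_send_P d = hdist (sum_dist d)"
  by (simp add: fun_eq_iff H_send_P_def hdist_def)

theorem Metric_space_P_USCB1: "Metric_space (P_USCB1 M d) (H_send_P d)"
proof -
  interpret S: Metric_space "M \<times> (UNIV :: real set)" "sum_dist d" by (rule Metric_space_sum_dist)
  show ?thesis
    unfolding H_send_P_eq
    by (rule Metric_space.subspace[OF S.Metric_space_hdist]) (use P_USCB1_imp_compact in blast)
qed

theorem mcomplete_P_USCB1:
  assumes "mcomplete"
  shows "Metric_space.mcomplete (P_USCB1 M d) (H_send_P d)"
proof -
  interpret S: Metric_space "M \<times> (UNIV :: real set)" "sum_dist d" by (rule Metric_space_sum_dist)
  interpret H: Metric_space "compact_sets (M \<times> UNIV) (sum_dist d)" "hdist (sum_dist d)"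
    by (rule S.Metric_space_hdist)
  interpret P: Submetric "compact_sets (M \<times> UNIV) (sum_dist d)" "hdist (sum_dist d)" "P_USCB1 M d"
    by unfold_locales (use P_USCB1_imp_compact in blast)
  have "closedin H.mtopology (P_USCB1 M d)"
    by (rule H.closedin_if_approx) (use P.subset P_USCB1_if_approx in auto)
  then show ?thesis
    unfolding H_send_P_eq
    using P.closedin_mcomplete_imp_mcomplete S.mcomplete_hdist mcomplete_sum_dist[OF assms] by blast
qed

end

section \<open>Sendographs of fuzzy sets\<close>

context Metric_space
begin

text \<open>
  At positive heights the restriction of the sendograph to \<open>level_cut M d u 0\<close> has no effect, because points of
  positive membership lie in \<open>level_cut M d u 0\<close>; at height \<open>0\<close> it is the only condition left.
\<close>

lemma slice_send:
  assumes u: "u \<in> F_USCB1 M d" and \<alpha>: "\<alpha> \<in> {0..1}"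
  shows "slice (send M d u) \<alpha> = level_cut M d u \<alpha>"
proof (cases "\<alpha> = 0")
  case True
  have "level_cut M d u 0 \<subseteq> M"
    using closure_of_subset_topspace[of mtopology] by (simp add: level_cut_def)
  moreover have "0 \<le> u x" if "x \<in> M" for x
    using u that by (auto simp: F_USCB1_def PiE_iff)
  ultimately show ?thesis using True by (auto simp: slice_def send_def)
next
  case False
  have "{x \<in> M. u x > 0} \<subseteq> level_cut M d u 0"
    unfolding level_cut_def using closure_of_subset[of "{x \<in> M. u x > 0}" mtopology] by simp
  then have "x \<in> level_cut M d u 0" if "x \<in> M" "u x \<ge> \<alpha>" for x
    using that \<alpha> False by auto
  then show ?thesis using \<alpha> False by (auto simp: slice_def send_def level_cut_def[of _ _ _ \<alpha>])
qed

lemma send_in_P_USCB1: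
  assumes u: "u \<in> F_USCB1 M d"
  shows "send M d u \<in> P_USCB1 M d"
proof -
  let ?L = "level_cut M d u"
  have L: "?L \<alpha> \<noteq> {}" "closedin mtopology (?L \<alpha>)" if "\<alpha> \<in> {0..1}" for \<alpha>
    using u that by (auto simp: F_USCB1_def closed_sets_def)
  have L0: "compactin mtopology (?L 0)"
    using u by (auto simp: F_USCB1_def compact_sets_def)
  have support: "{x \<in> M. u x > 0} \<subseteq> ?L 0"
    unfolding level_cut_def using closure_of_subset[of "{x \<in> M. u x > 0}" mtopology] by simp
  have L_sub: "?L \<alpha> \<subseteq> ?L 0" if "\<alpha> \<in> {0..1}" for \<alpha>
    using support that by (cases "\<alpha> = 0") (auto simp: level_cut_def[of _ _ _ \<alpha>])
  have "slice (send M d u) \<alpha> \<in> compact_sets M d" if "\<alpha> \<in> {0..1}" for \<alpha>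
    using closed_compactin[OF L0 L_sub[OF that] L(2)[OF that]] L(1)[OF that]
    by (simp add: slice_send[OF u that] compact_sets_def)
  moreover have "slice (send M d u) \<alpha> = (\<Inter>\<beta>\<in>{0..<\<alpha>}. slice (send M d u) \<beta>)"
    if \<alpha>: "\<alpha> \<in> {0<..1}" for \<alpha>
  proof -
    have "?L \<alpha> = (\<Inter>\<beta>\<in>{0..<\<alpha>}. ?L \<beta>)"
    proof
      show "?L \<alpha> \<subseteq> (\<Inter>\<beta>\<in>{0..<\<alpha>}. ?L \<beta>)"
      proof (intro INT_greatest)
        fix \<beta> assume \<beta>: "\<beta> \<in> {0..<\<alpha>}"
        show "?L \<alpha> \<subseteq> ?L \<beta>"
          using L_sub[of \<alpha>] \<alpha> \<beta> by (cases "\<beta> = 0") (auto simp: level_cut_def)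
      qed
      show "(\<Inter>\<beta>\<in>{0..<\<alpha>}. ?L \<beta>) \<subseteq> ?L \<alpha>"
      proof
        fix x assume x: "x \<in> (\<Inter>\<beta>\<in>{0..<\<alpha>}. ?L \<beta>)"
        have level: "x \<in> M \<and> \<beta> \<le> u x" if \<beta>: "0 < \<beta>" "\<beta> < \<alpha>" for \<beta>
        proof -
          have "x \<in> ?L \<beta>" using x \<beta> by auto
          then show ?thesis using \<beta> by (simp add: level_cut_def)
        qed
        have "\<alpha> \<le> u x"
          by (rule dense_le_bounded[of 0]) (use level \<alpha> in auto)
        moreover have "x \<in> M" using level[of "\<alpha> / 2"] \<alpha> by auto
        ultimately show "x \<in> ?L \<alpha>" using \<alpha> by (auto simp: level_cut_def)
      qed
    qed
    moreover have "(\<Inter>\<beta>\<in>{0..<\<alpha>}. slice (send M d u) \<beta>) = (\<Inter>\<beta>\<in>{0..<\<alpha>}. ?L \<beta>)"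
      by (intro INF_cong refl slice_send[OF u]) (use \<alpha> in auto)
    ultimately show ?thesis using slice_send[OF u, of \<alpha>] \<alpha> by simp
  qed
  moreover have "send M d u \<subseteq> M \<times> {0..1}" by (auto simp: send_def)
  ultimately show ?thesis by (simp add: P_USCB1_def)
qed

text \<open>
  Equal sendographs have equal level cuts, and comparing at the level \<open>u x\<close> gives \<open>u x \<le> v x\<close>.
\<close>

lemma inj_on_send: "inj_on (send M d) (F_USCB1 M d)"
proof (rule inj_onI)
  have le: "u x \<le> v x"
    if u: "u \<in> F_USCB1 M d" and v: "v \<in> F_USCB1 M d" and eq: "send M d u = send M d v"
      and x: "x \<in> M" for u v x
  proof (cases "u x = 0")
    case True
    then show ?thesis using v x by (auto simp: F_USCB1_def PiE_iff)
  next
    case False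
    then have ux: "0 < u x" "u x \<in> {0..1}" using u x by (force simp: F_USCB1_def PiE_iff)+
    then have "level_cut M d u (u x) = level_cut M d v (u x)"
      using slice_send[OF u] slice_send[OF v] eq by metis
    moreover have "x \<in> level_cut M d u (u x)" using x ux by (simp add: level_cut_def)
    ultimately show ?thesis using ux by (simp add: level_cut_def)
  qed
  fix u v assume u: "u \<in> F_USCB1 M d" and v: "v \<in> F_USCB1 M d" and eq: "send M d u = send M d v"
  show "u = v"
  proof (rule PiE_ext)
    show "u \<in> M \<rightarrow>\<^sub>E {0..1}" "v \<in> M \<rightarrow>\<^sub>E {0..1}" using u v by (auto simp: F_USCB1_def)
    show "u x = v x" if "x \<in> M" for x using le[OF u v eq that] le[OF v u eq[symmetric] that] by simp
  qed
qed

lemma H_send_F_eq: "H_send_F M d u v = H_send_P d (send M d u) (send M d v)"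
  by (simp add: H_send_F_def H_send_P_def)

theorem Metric_space_F_USCB1: "Metric_space (F_USCB1 M d) (H_send_F M d)"
proof -
  interpret P: Metric_space "P_USCB1 M d" "H_send_P d" by (rule Metric_space_P_USCB1)
  show ?thesis
  proof
    show "H_send_F M d u v = 0 \<longleftrightarrow> u = v" if "u \<in> F_USCB1 M d" "v \<in> F_USCB1 M d" for u v
      using that inj_on_send by (simp add: H_send_F_eq send_in_P_USCB1 inj_on_eq_iff)
  qed (simp_all add: H_send_F_eq P.commute P.triangle send_in_P_USCB1)
qed

text \<open>
  The smallest set containing the points of \<open>K\<close> and everything vertically below them, down to
  height \<open>0\<close>.
\<close>

definition subgraph :: "('a \<times> real) set \<Rightarrow> ('a \<times> real) set"
  where "subgraph K = {(x, t). 0 \<le> t \<and> (\<exists>s. (x, s) \<in> K \<and> t \<le> s)}"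

text \<open>
  The fuzzy set takes at \<open>x\<close> the largest height of a point of \<open>K\<close> above \<open>x\<close>. All its level cuts
  are finite, hence compact. Heights must be positive because a point of height \<open>0\<close> would belong to
  the subgraph, but its base point need not be in the closure of the support.
\<close>

lemma finite_subgraph_is_send:
  assumes fin: "finite K" and K: "K \<subseteq> M \<times> {0<..1}" and one: "slice K 1 \<noteq> {}"
  shows "\<exists>u\<in>F_USCB1 M d. send M d u = subgraph K"
proof -
  \<comment> \<open>Inserting \<open>0\<close> gives the value off the support and keeps the set nonempty.\<close>
  define u where "u = (\<lambda>x\<in>M. Max (insert 0 {s. (x, s) \<in> K}))"
  have fin': "finite {s. (x, s) \<in> K}" for x
    by (rule finite_subset[OF _ finite_imageI[OF fin, of snd]]) force
  have ge: "t \<le> u x \<longleftrightarrow> (\<exists>s. (x, s) \<in> K \<and> t \<le> s)" if "0 < t" "x \<in> M" for x t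
    using that fin'[of x] by (auto simp: u_def Max_ge_iff)
  have gr: "0 < u x \<longleftrightarrow> x \<in> fst ` K" if "x \<in> M" for x
    using that fin'[of x] K by (force simp: u_def Max_gr_iff image_iff)
  have fstK: "fst ` K \<subseteq> M" "finite (fst ` K)" using K fin by auto
  have fin_closed: "closedin mtopology A" if "A \<subseteq> fst ` K" for A
    using that fstK finite_subset[of A "fst ` K"]
    by (intro closedin_Hausdorff_finite Hausdorff_space_mtopology) auto
  have "{x \<in> M. u x > 0} = fst ` K" using gr fstK by blast
  then have L0: "level_cut M d u 0 = fst ` K"
    using closure_of_closedin[OF fin_closed[OF order_refl]] by (simp add: level_cut_def)
  obtain x1 where x1: "(x1, 1) \<in> K" "x1 \<in> M" using one K by (auto simp: slice_def)
  have L: "level_cut M d u \<alpha> \<subseteq> fst ` K \<and> x1 \<in> level_cut M d u \<alpha>" if "\<alpha> \<in> {0..1}" for \<alpha>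
  proof (cases "\<alpha> = 0")
    case True
    then show ?thesis using L0 x1 by force
  next
    case False
    then have "\<alpha> > 0" "\<alpha> \<le> 1" using that by auto
    then show ?thesis using False ge x1 by (force simp: level_cut_def image_iff)
  qed
  have "u \<in> F_USCB1 M d"
    unfolding F_USCB1_def
  proof (intro CollectI conjI ballI)
    show "u \<in> M \<rightarrow>\<^sub>E {0..1}"
    proof
      fix x assume "x \<in> M"
      moreover have "Max (insert 0 {s. (x, s) \<in> K}) \<le> 1"
        using K fin'[of x] by (subst Max_le_iff) auto
      ultimately show "u x \<in> {0..1}" using fin'[of x] by (auto simp: u_def)
    qed (simp add: u_def)
    show "level_cut M d u \<alpha> \<in> closed_sets M d" if "\<alpha> \<in> {0..1}" for \<alpha>
      using L[OF that] fin_closed by (auto simp: closed_sets_def)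
    show "level_cut M d u 0 \<in> compact_sets M d"
      using L[of 0] fstK finite_imp_compactin[of "fst ` K" mtopology]
      by (auto simp: compact_sets_def L0)
  qed
  moreover have "send M d u = subgraph K"
  proof (rule set_eqI, clarify)
    fix x :: 'a and t :: real
    have u01: "0 \<le> u x" if "x \<in> M"
      using that \<open>u \<in> F_USCB1 M d\<close> by (auto simp: F_USCB1_def PiE_iff)
    consider "t < 0" | "t = 0" | "t > 0" by linarith
    then show "(x, t) \<in> send M d u \<longleftrightarrow> (x, t) \<in> subgraph K"
    proof cases
      case 1
      then show ?thesis by (auto simp: send_def subgraph_def)
    next
      case 2
      then show ?thesis using K L0 fstK u01 by (force simp: send_def subgraph_def image_iff)
    next
      case 3
      have inK: "x \<in> M \<and> s \<le> 1 \<and> x \<in> fst ` K" if "(x, s) \<in> K" for s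
        using that K by force
      show ?thesis
        using ge[OF 3, of x] 3 by (auto simp: send_def subgraph_def L0 dest: inK)
    qed
  qed
  ultimately show ?thesis by blast
qed

end

section \<open>Passing to the completion\<close>

locale isometric_embedding = X: Metric_space X d + Y: Metric_space Y \<rho>
  for X :: "'a set" and d and Y :: "'b set" and \<rho> +
  fixes e :: "'a \<Rightarrow> 'b"
  assumes maps: "e \<in> X \<rightarrow> Y"
    and isometric: "\<And>x y. x \<in> X \<Longrightarrow> y \<in> X \<Longrightarrow> \<rho> (e x) (e y) = d x y"
begin

lemma inj_on_e: "inj_on e X"
proof (rule inj_onI)
  fix x y assume "x \<in> X" "y \<in> X" "e x = e y"
  then have "d x y = \<rho> (e x) (e x)" using isometric by metis
  also have "\<dots> = 0" using maps \<open>x \<in> X\<close> by (auto simp: Pi_iff)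
  finally show "x = y" using \<open>x \<in> X\<close> \<open>y \<in> X\<close> by simp
qed

lemma compact_sets_image:
  assumes "A \<in> compact_sets X d"
  shows "e ` A \<in> compact_sets Y \<rho>"
proof -
  have "continuous_map X.mtopology Y.mtopology e"
    unfolding X.metric_continuous_map[OF Y.Metric_space_axioms]
    using maps isometric by (auto simp: Pi_iff)
  then show ?thesis
    using assms image_compactin by (auto simp: compact_sets_def)
qed

lemma slice_image: "slice (map_prod e id ` w) = (\<lambda>\<alpha>. e ` slice w \<alpha>)"
  by (force simp: slice_def fun_eq_iff)

lemma P_USCB1_image:
  assumes w: "w \<in> P_USCB1 X d"
  shows "map_prod e id ` w \<in> P_USCB1 Y \<rho>"
  unfolding P_USCB1_def
proof (intro CollectI conjI ballI)
  have sub: "w \<subseteq> X \<times> {0..1}" using w by (simp add: P_USCB1_def)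
  then show "map_prod e id ` w \<subseteq> Y \<times> {0..1}" using maps by fastforce
  show "slice (map_prod e id ` w) \<alpha> \<in> compact_sets Y \<rho>" if "\<alpha> \<in> {0..1}" for \<alpha>
    unfolding slice_image using w that by (intro compact_sets_image) (simp add: P_USCB1_def)
  show "slice (map_prod e id ` w) \<alpha> = (\<Inter>\<beta>\<in>{0..<\<alpha>}. slice (map_prod e id ` w) \<beta>)"
    if \<alpha>: "\<alpha> \<in> {0<..1}" for \<alpha>
  proof -
    have "slice w \<alpha> = (\<Inter>\<beta>\<in>{0..<\<alpha>}. slice w \<beta>)" using w \<alpha> by (auto simp: P_USCB1_def)
    then have "e ` slice w \<alpha> = e ` (\<Inter>\<beta>\<in>{0..<\<alpha>}. slice w \<beta>)" by (rule arg_cong)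
    also have "\<dots> = (\<Inter>\<beta>\<in>{0..<\<alpha>}. e ` slice w \<beta>)"
      by (rule image_INT[OF inj_on_e, of _ _ 0]) (use sub \<alpha> in \<open>auto simp: slice_def\<close>)
    finally show ?thesis unfolding slice_image .
  qed
qed

lemma send_image_isometric:
  "H_send_P \<rho> (map_prod e id ` send X d u) (map_prod e id ` send X d v) = H_send_F X d u v"
proof -
  have "sum_dist \<rho> (map_prod e id p) (map_prod e id q) = sum_dist d p q"
    if "p \<in> send X d u" "q \<in> send X d v" for p q
    using that isometric by (auto simp: send_def sum_dist_def)
  then show ?thesis
    unfolding X.H_send_F_eq X.H_send_P_eq Y.H_send_P_eq by (rule hdist_isometric_image)
qed

text \<open>
  The approximating fuzzy set is generated by a finite \<open>\<delta>\<close>-net of \<open>w\<close> whose base points are moved by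
  less than \<open>\<delta>\<close> into \<open>X\<close> and whose heights are lifted to at least \<open>\<delta>\<close>. Each of the two directions of
  the Hausdorff distance costs at most \<open>\<delta>\<close> for the move of the base point and \<open>\<delta>\<close> for the rest.
\<close>

lemma send_image_dense:
  assumes dense: "Y.mtopology closure_of (e ` X) = Y"
    and w: "w \<in> P_USCB1 Y \<rho>" and "\<epsilon> > 0"
  shows "\<exists>u\<in>F_USCB1 X d. H_send_P \<rho> w (map_prod e id ` send X d u) < \<epsilon>"
proof -
  interpret S: Metric_space "Y \<times> (UNIV :: real set)" "sum_dist \<rho>" by (rule Y.Metric_space_sum_dist)
  define \<delta> where "\<delta> = min 1 (\<epsilon> / 3)"
  have \<delta>: "0 < \<delta>" "\<delta> \<le> 1" "2 * \<delta> < \<epsilon>" using \<open>\<epsilon> > 0\<close> by (auto simp: \<delta>_def min_def)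
  have w_sub: "w \<subseteq> Y \<times> {0..1}" and w_comp: "w \<in> compact_sets (Y \<times> UNIV) (sum_dist \<rho>)"
    and down: "\<And>y t s. (y, t) \<in> w \<Longrightarrow> 0 \<le> s \<Longrightarrow> s \<le> t \<Longrightarrow> (y, s) \<in> w"
    using w unfolding Y.P_USCB1_iff by blast+
  obtain y1 where y1: "(y1, 1) \<in> w" using w by (auto simp: Y.P_USCB1_iff slice_def)
  have "S.mtotally_bounded w"
    using w_comp S.compactin_imp_mtotally_bounded by (simp add: compact_sets_def)
  then obtain K where K: "finite K" "K \<subseteq> w" "w \<subseteq> (\<Union>p\<in>K. S.mball p \<delta>)"
    unfolding S.mtotally_bounded_def using \<delta>(1) by meson
  \<comment> \<open>A net need not contain a point of height \<open>1\<close>, but the fuzzy set must attain the value \<open>1\<close>.\<close>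
  define N where "N = insert (y1, 1) K"
  have N: "finite N" "N \<subseteq> w" using K y1 by (auto simp: N_def)
  have "\<exists>x\<in>X. \<rho> y (e x) < \<delta>" if "y \<in> Y" for y
  proof -
    have "y \<in> Y.mtopology closure_of (e ` X)" using dense that by simp
    then show ?thesis using \<delta>(1) unfolding Y.metric_closure_of Y.in_mball by blast
  qed
  then obtain g where g: "\<And>y. y \<in> Y \<Longrightarrow> g y \<in> X" "\<And>y. y \<in> Y \<Longrightarrow> \<rho> y (e (g y)) < \<delta>"
    by metis
  define h where "h p = (g (fst p), max (snd p) \<delta>)" for p
  have NY: "fst p \<in> Y" "0 \<le> snd p" "snd p \<le> 1" if "p \<in> N" for p
    using that N w_sub by auto
  have "finite (h ` N)" using N by simp
  moreover have "h ` N \<subseteq> X \<times> {0<..1}"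
    using NY g(1) \<delta> by (auto simp: h_def)
  moreover have "slice (h ` N) 1 \<noteq> {}"
  proof -
    have "h (y1, 1) = (g y1, 1)" using \<delta> by (simp add: h_def)
    then have "(g y1, 1) \<in> h ` N" by (metis N_def image_eqI insertI1)
    then show ?thesis by (auto simp: slice_def)
  qed
  ultimately obtain u where u: "u \<in> F_USCB1 X d" and send_u: "send X d u = X.subgraph (h ` N)"
    using X.finite_subgraph_is_send by meson
  have in_image: "(e (g (fst p)), t) \<in> map_prod e id ` send X d u"
    if "p \<in> N" "0 \<le> t" "t \<le> max (snd p) \<delta>" for p t
  proof -
    have "(g (fst p), t) \<in> send X d u"
      using that unfolding send_u X.subgraph_def h_def by blast
    then show ?thesis by force
  qed
  have "hdist (sum_dist \<rho>) w (map_prod e id ` send X d u) \<le> 2 * \<delta>"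
  proof (rule hdist_leI)
    fix z assume "z \<in> w"
    then obtain p where "p \<in> K" "z \<in> S.mball p \<delta>" using K(3) by blast
    then have p: "p \<in> N" "sum_dist \<rho> p z < \<delta>" unfolding S.in_mball N_def by blast+
    \<comment> \<open>The largest height up to \<open>snd z\<close> in the lifted column generated by \<open>p\<close>; as this column
      reaches height \<open>snd p\<close> at least, truncation costs at most \<open>|snd p - snd z|\<close>.\<close>
    define t where "t = min (snd z) (max (snd p) \<delta>)"
    have z: "fst z \<in> Y" "0 \<le> snd z" using \<open>z \<in> w\<close> w_sub by auto
    have "\<bar>snd z - t\<bar> \<le> \<bar>snd p - snd z\<bar>" by (auto simp: t_def)
    moreover have "\<rho> (fst z) (e (g (fst p))) \<le> \<rho> (fst p) (fst z) + \<rho> (fst p) (e (g (fst p)))"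
      using Y.triangle[of "fst z" "fst p" "e (g (fst p))"] z NY[OF p(1)] g(1) maps
      by (simp add: Y.commute Pi_iff)
    ultimately have "sum_dist \<rho> z (e (g (fst p)), t) \<le> 2 * \<delta>"
      using p(2) g(2)[OF NY(1)[OF p(1)]] by (simp add: sum_dist_def)
    moreover have "(e (g (fst p)), t) \<in> map_prod e id ` send X d u"
      using in_image[OF p(1)] z \<delta> by (simp add: t_def)
    ultimately show "\<exists>q\<in>map_prod e id ` send X d u. sum_dist \<rho> z q \<le> 2 * \<delta>" by (rule bexI)
  next
    fix q assume "q \<in> map_prod e id ` send X d u"
    then obtain p t where p: "p \<in> N" and t: "0 \<le> t" "t \<le> max (snd p) \<delta>"
      and q: "q = (e (g (fst p)), t)"
      unfolding send_u X.subgraph_def h_def by auto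
    \<comment> \<open>Lowering \<open>t\<close> to the original height undoes the lift, which is at most \<open>\<delta>\<close>.\<close>
    have "(fst p, min t (snd p)) \<in> w"
      using down[of "fst p" "snd p"] p N t NY[OF p] by auto
    moreover have "sum_dist \<rho> (fst p, min t (snd p)) q \<le> 2 * \<delta>"
      using g(2)[OF NY(1)[OF p]] t NY[OF p] \<delta>(1) by (auto simp: q sum_dist_def)
    ultimately show "\<exists>z\<in>w. sum_dist \<rho> z q \<le> 2 * \<delta>" by (rule rev_bexI)
  qed (use \<delta> in simp)
  then show ?thesis using u \<delta>(3) by (intro bexI[of _ u]) (simp_all add: Y.H_send_P_eq)
qed

end

theorem theorem8p6:
  fixes X :: "'a set" and d :: "'a \<Rightarrow> 'a \<Rightarrow> real"
    and X' :: "'b set" and d' :: "'b \<Rightarrow> 'b \<Rightarrow> real"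
    and e :: "'a \<Rightarrow> 'b"
  assumes "X \<noteq> {}"
    and "completion_via e X d X' d'"
  shows "completion_via (\<lambda>u. map_prod e id ` send X d u)
           (F_USCB1 X d) (H_send_F X d) (P_USCB1 X' d') (H_send_P d')"
proof -
  have comp: "Metric_space X d" "Metric_space X' d'" "Metric_space.mcomplete X' d'"
    "e \<in> X \<rightarrow> X'" "\<And>x y. x \<in> X \<Longrightarrow> y \<in> X \<Longrightarrow> d' (e x) (e y) = d x y"
    "Metric_space.mtopology X' d' closure_of (e ` X) = X'"
    using assms(2) by (auto simp: completion_via_def)
  interpret isometric_embedding X d X' d' e
    using comp by (intro isometric_embedding.intro isometric_embedding_axioms.intro)
  interpret P: Metric_space "P_USCB1 X' d'" "H_send_P d'" by (rule Y.Metric_space_P_USCB1)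
  let ?E = "\<lambda>u. map_prod e id ` send X d u"
  have E: "?E u \<in> P_USCB1 X' d'" if "u \<in> F_USCB1 X d" for u
    using that X.send_in_P_USCB1 P_USCB1_image by blast
  have "P_USCB1 X' d' \<subseteq> P.mtopology closure_of (?E ` F_USCB1 X d)"
  proof
    fix w assume w: "w \<in> P_USCB1 X' d'"
    have "\<exists>v\<in>?E ` F_USCB1 X d. v \<in> P.mball w \<epsilon>" if "\<epsilon> > 0" for \<epsilon>
      using send_image_dense[OF comp(6) w that] w E by auto
    then show "w \<in> P.mtopology closure_of (?E ` F_USCB1 X d)"
      using w by (simp add: P.metric_closure_of)
  qed
  then have "P.mtopology closure_of (?E ` F_USCB1 X d) = P_USCB1 X' d'"
    using closure_of_subset_topspace[of P.mtopology] by (intro subset_antisym) simp_all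
  then show ?thesis
    unfolding completion_via_def
    using X.Metric_space_F_USCB1 P.Metric_space_axioms Y.mcomplete_P_USCB1[OF comp(3)] E
      send_image_isometric by (intro conjI funcsetI ballI)
qed

end
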